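(* Let $H_{K,M}^{(G)}$ be the (closed-form) generalized CUSUM test statistic and $H_{K,M}^{(A)}$ the alternative test statistic defined in the context. For any given $K<\infty$, $$\lim_{M\to\infty}\left|H_{K,M}^{(A)}-H_{K,M}^{(G)}\right|=0\quad\text{almost surely},$$ no matter whether attacks occur or not.
   Context: Model. $\mathcal{N}$ is a set of $N\ge1$ sensors, partitioned into a set $\mathcal{S}$ of $N_{\mathcal{S}}$ secure sensors (possibly empty) and a set $\mathcal{A}=\mathcal{N}\setminus\mathcal{S}$ of $N_{\mathcal{A}}$ insecure sensors. $F$ is the common cdf of the i.i.d. additive noise; $F$ is invertible, i.e. a continuous strictly increasing bijection $\mathbb{R}\to(0,1)$, with the conventions $F(\pm\infty)\in\{0,1\}$, $F^{-1}(0)=-\infty$, $F^{-1}(1)=+\infty$. $\tau\in\mathbb{R}$ is the quantizer threshold, $\theta\in\mathbb{R}$ an unknown deterministic parameter, $b>0$ a prescribed constant. An unattacked sensor at each time observes $x=\theta+n$ (noise $n$ with cdf $F$); an attacked sensor $j\in\mathcal{A}$ observes $x=\theta+\mu_j+n$ with deterministic $\mu_j\ge b$; each sensor outputs the bit $\mathbf{1}\{x>\tau\}$. All noise samples are independent. The bits in an initial secure (attack-free) period of length $M$ are $\check u_j^{(m)}$, $m=1,\dots,M$; the bits after the secure period are relabeled $u_j^{(k)}$, $k=1,2,\dots$ ($j\in\mathcal{N}$). If attacks occur, all sensors in $\mathcal{A}$ are attacked from some common (relabeled) time onward; otherwise none is ever attacked. In the limit $M\to\infty$, $(\check u_j^{(m)})_{m\ge1}$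 are infinite i.i.d. sequences with $\Pr(\check u_j^{(m)}=0)=F(\tau-\theta)$, and the bits $u_j^{(i)}$, $1\le i\le K$, are held as given. Likelihoods: $\mathbb{P}_0(0\mid\vartheta)=F(\tau-\vartheta)$, $\mathbb{P}_0(1\mid\vartheta)=1-F(\tau-\vartheta)$, $\mathbb{P}_1(0\mid\vartheta,\mu)=F(\tau-\vartheta-\mu)$, $\mathbb{P}_1(1\mid\vartheta,\mu)=1-F(\tau-\vartheta-\mu)$. Estimators, for $1\le k\le K$: $$\hat\theta_{\rm MLE}^{(u)}=\tau-F^{-1}\Big[1-\tfrac{1}{(M+K)N}\sum_{j\in\mathcal{N}}\Big(\sum_{m=1}^M\check u_j^{(m)}+\sum_{i=1}^Ku_j^{(i)}\Big)\Big],$$ $$\hat\theta^{(a)}=\tau-F^{-1}\Big[1-\tfrac{1}{MN+KN_{\mathcal{S}}}\Big(\sum_{j\in\mathcal{N}}\sum_{m=1}^M\check u_j^{(m)}+\sum_{j\in\mathcal{S}}\sum_{i=1}^Ku_j^{(i)}\Big)\Big],$$ $$\tilde\mu_j=\tau-\hat\theta^{(a)}-F^{-1}\Big[1-\tfrac{1}{K-k+1}\sum_{i=k}^Ku_j^{(i)}\Big],\qquad \hat\mu_j=\max\{\tilde\mu_j,b\}\quad(j\in\mathcal{A}).$$ Statistics: $$\eta_{K,M}^{(1)}=\sum_{m=1}^M\sum_{j\in\mathcal{N}}\ln\frac{\mathbb{P}_0(\check u_j^{(m)}\mid\hat\theta^{(a)})}{\mathbb{P}_0(\check u_j^{(m)}\mid\hat\theta^{(u)}_{\rm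 MLE})},\qquad \eta_{K,M}^{(2)}=\sum_{i=1}^K\sum_{j\in\mathcal{S}}\ln\frac{\mathbb{P}_0(u_j^{(i)}\mid\hat\theta^{(a)})}{\mathbb{P}_0(u_j^{(i)}\mid\hat\theta^{(u)}_{\rm MLE})},$$ and, depending on $k$, $$\eta_{K,M}^{(3)}=\sum_{i=1}^{k-1}\sum_{j\in\mathcal{A}}\ln\frac{\mathbb{P}_0(u_j^{(i)}\mid\hat\theta^{(a)})}{\mathbb{P}_0(u_j^{(i)}\mid\hat\theta^{(u)}_{\rm MLE})},\qquad \eta_{K,M}^{(4)}=\sum_{i=k}^{K}\sum_{j\in\mathcal{A}}\ln\frac{\mathbb{P}_1(u_j^{(i)}\mid\hat\theta^{(a)},\hat\mu_j)}{\mathbb{P}_0(u_j^{(i)}\mid\hat\theta^{(u)}_{\rm MLE})}.$$ Test statistics: $$H_{K,M}^{(G)}=\eta_{K,M}^{(1)}+\eta_{K,M}^{(2)}+\max_{1\le k\le K}\{\eta_{K,M}^{(3)}+\eta_{K,M}^{(4)}\},\qquad H_{K,M}^{(A)}=\eta_{K,M}^{(1)}+\eta_{K,M}^{(2)}+\max_{1\le k\le K}\eta_{K,M}^{(4)}.$$ (Almost surely, all these quantities are well defined and finite for all sufficiently large $M$.) *)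

theory Defs
  imports "HOL-Probability.Probability" "HOL-Library.Extended_Nat"
begin

text \<open>
  Throughout, \<open>N\<close> is the set of all sensors, \<open>S \<subseteq> N\<close> the secure ones and \<open>N - S\<close> the insecure ones.
  A bit is a \<open>bool\<close>, \<open>True\<close> standing for 1. Bit arrays are indexed by sensor and time, times
  start at 1; \<open>v\<close> holds the bits of the secure period, \<open>u\<close> those after it (relabelled).
\<close>

section \<open>Noise distribution with the conventions at infinity\<close>

definition cdf_ext :: "(real \<Rightarrow> real) \<Rightarrow> ereal \<Rightarrow> real" where
  "cdf_ext F x = (if x = \<infinity> then 1 else if x = -\<infinity> then 0 else F (real_of_ereal x))"

definition quantile :: "(real \<Rightarrow> real) \<Rightarrow> real \<Rightarrow> ereal" where
  "quantile F p = (if p = 0 then -\<infinity> else if p = 1 then \<infinity> else ereal (inv F p))"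


section \<open>Observation model\<close>

definition secure_period_bits ::
  "real \<Rightarrow> real \<Rightarrow> ('a \<Rightarrow> nat \<Rightarrow> 'w \<Rightarrow> real) \<Rightarrow> 'w \<Rightarrow> 'a \<Rightarrow> nat \<Rightarrow> bool" where
  "secure_period_bits \<tau> \<theta> n0 \<omega> j m \<longleftrightarrow> \<theta> + n0 j m \<omega> > \<tau>"

text \<open>
  \<open>t\<^sub>A\<close> is the common time from which on all insecure sensors are attacked;
  \<open>t\<^sub>A = \<infinity>\<close> means that no attack ever occurs.
\<close>

definition post_period_bits ::
  "real \<Rightarrow> real \<Rightarrow> 'a set \<Rightarrow> 'a set \<Rightarrow> ('a \<Rightarrow> real) \<Rightarrow> enat \<Rightarrow> ('a \<Rightarrow> nat \<Rightarrow> 'w \<Rightarrow> real)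
    \<Rightarrow> 'w \<Rightarrow> 'a \<Rightarrow> nat \<Rightarrow> bool" where
  "post_period_bits \<tau> \<theta> N S \<mu> t\<^sub>A n1 \<omega> j k \<longleftrightarrow>
     \<theta> + (if j \<in> N - S \<and> t\<^sub>A \<le> enat k then \<mu> j else 0) + n1 j k \<omega> > \<tau>"

text \<open>
  \<open>n0\<close> is the noise during the secure period, of which the first \<open>M\<close> times are used when its
  length is \<open>M\<close> (hence an infinite sequence), and \<open>n1\<close> the noise after it.
\<close>

locale sensor_network = prob_space P
  for P :: "'w measure" +
  fixes F :: "real \<Rightarrow> real"
    and b :: real
    and N S :: "'a set"
    and \<mu> :: "'a \<Rightarrow> real"
    and t\<^sub>A :: enat
    and n0 n1 :: "'a \<Rightarrow> nat \<Rightarrow> 'w \<Rightarrow> real"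
  assumes finite_sensors: "finite N"
    and sensors_nonempty: "N \<noteq> {}"
    and secure_subset: "S \<subseteq> N"
    and F_continuous: "continuous_on UNIV F"
    and F_strict_mono: "strict_mono F"
    and F_range: "range F = {0<..<1}"
    and b_pos: "b > 0"
    and attack_strength: "\<And>j. j \<in> N - S \<Longrightarrow> \<mu> j \<ge> b"
    and attack_time: "t\<^sub>A \<ge> 1"
    and noise_indep: "indep_vars (\<lambda>_. borel) (case_sum (\<lambda>(j, m). n0 j m) (\<lambda>(j, k). n1 j k))
                        ((N \<times> {1..}) <+> (N \<times> {1..}))"
    and n0_cdf: "\<And>j m. j \<in> N \<Longrightarrow> m \<ge> 1 \<Longrightarrow> cdf (distr P borel (n0 j m)) = F"
    and n1_cdf: "\<And>j k. j \<in> N \<Longrightarrow> k \<ge> 1 \<Longrightarrow> cdf (distr P borel (n1 j k)) = F"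


section \<open>Likelihoods and estimators\<close>

definition lik0 :: "(real \<Rightarrow> real) \<Rightarrow> real \<Rightarrow> bool \<Rightarrow> ereal \<Rightarrow> real" where
  "lik0 F \<tau> x t = (if x then 1 - cdf_ext F (ereal \<tau> - t) else cdf_ext F (ereal \<tau> - t))"

definition lik1 :: "(real \<Rightarrow> real) \<Rightarrow> real \<Rightarrow> bool \<Rightarrow> ereal \<Rightarrow> ereal \<Rightarrow> real" where
  "lik1 F \<tau> x t \<mu> =
     (if x then 1 - cdf_ext F (ereal \<tau> - t - \<mu>) else cdf_ext F (ereal \<tau> - t - \<mu>))"

context
  fixes F :: "real \<Rightarrow> real"
    and \<tau> b :: real
    and N S :: "'a set"
    and v u :: "'a \<Rightarrow> nat \<Rightarrow> bool"
    and K M :: nat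
begin

text \<open>
  The estimate of the attack strength can be genuinely infinite (all bits of a sensor from time \<open>k\<close>
  on equal to 1), so the estimators take values in \<^typ>\<open>ereal\<close>.
\<close>

definition theta_mle :: ereal where
  "theta_mle = ereal \<tau> - quantile F (1 - 1 / real ((M + K) * card N) *
     (\<Sum>j\<in>N. (\<Sum>m=1..M. of_bool (v j m)) + (\<Sum>i=1..K. of_bool (u j i))))"

definition theta_a :: ereal where
  "theta_a = ereal \<tau> - quantile F (1 - 1 / real (M * card N + K * card S) *
     ((\<Sum>j\<in>N. \<Sum>m=1..M. of_bool (v j m)) + (\<Sum>j\<in>S. \<Sum>i=1..K. of_bool (u j i))))"

definition mu_tilde :: "nat \<Rightarrow> 'a \<Rightarrow> ereal" where
  "mu_tilde k j = ereal \<tau> - theta_a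
     - quantile F (1 - 1 / real (K - k + 1) * (\<Sum>i=k..K. of_bool (u j i)))"

definition mu_hat :: "nat \<Rightarrow> 'a \<Rightarrow> ereal" where
  "mu_hat k j = max (mu_tilde k j) (ereal b)"


section \<open>Test statistics\<close>

text \<open>
  Logarithms are real-valued. The likelihoods below can vanish, and \<open>theta_a\<close> and \<open>theta_mle\<close> can be
  infinite, only as long as the bits of the secure period up to \<open>M\<close> are all equal; almost surely
  this concerns finitely many \<open>M\<close> only.
\<close>

definition eta1 :: real where
  "eta1 = (\<Sum>m=1..M. \<Sum>j\<in>N. ln (lik0 F \<tau> (v j m) theta_a / lik0 F \<tau> (v j m) theta_mle))"

definition eta2 :: real where
  "eta2 = (\<Sum>i=1..K. \<Sum>j\<in>S. ln (lik0 F \<tau> (u j i) theta_a / lik0 F \<tau> (u j i) theta_mle))"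

definition eta3 :: "nat \<Rightarrow> real" where
  "eta3 k = (\<Sum>i=1..k-1. \<Sum>j\<in>N-S. ln (lik0 F \<tau> (u j i) theta_a / lik0 F \<tau> (u j i) theta_mle))"

definition eta4 :: "nat \<Rightarrow> real" where
  "eta4 k = (\<Sum>i=k..K. \<Sum>j\<in>N-S.
     ln (lik1 F \<tau> (u j i) theta_a (mu_hat k j) / lik0 F \<tau> (u j i) theta_mle))"

definition H_G :: real where
  "H_G = eta1 + eta2 + Max ((\<lambda>k. eta3 k + eta4 k) ` {1..K})"

definition H_A :: real where
  "H_A = eta1 + eta2 + Max (eta4 ` {1..K})"

end

end

theory Submission
  imports Defs "HOL-Real_Asymp.Real_Asymp"
begin

text \<open>
  The maximum is 1-Lipschitz in the sup norm, so \<open>\<bar>H_A - H_G\<bar> \<le> Max\<^sub>k \<bar>eta3 k\<bar>\<close>, and it is enough that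
  the two likelihoods in \<open>eta3\<close> have ratio tending to 1. Inserting the estimators into \<open>lik0\<close>
  cancels the quantile and leaves the empirical frequency of the bit: \<open>(C + c) / D\<close> against
  \<open>(C + d) / E\<close>, where \<open>C\<close> counts the occurrences of the bit among the first \<open>M\<close> times of the secure
  period, \<open>c\<close> and \<open>d\<close> do not depend on \<open>M\<close>, and \<open>D / E \<longlonglongrightarrow> 1\<close>. This ratio tends to 1 as soon as
  \<open>C \<longlonglongrightarrow> \<infinity>\<close>. Hence no law of large numbers is needed, only that almost surely both bits occur
  infinitely often during the secure period, which follows from independence.
\<close>

section \<open>Recurrence of independent events\<close>

text \<open>A Borel-Cantelli argument for events of constant probability: missing every index
  outside a finite \<open>C\<close> has probability at most \<open>(1 - p) ^ L\<close> for all
  \<open>L\<close>, hence 0. Infinitely many hits follow by intersecting over the countably many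
  finite \<open>C\<close>.\<close>

lemma (in prob_space) AE_infinitely_often_indep_vars:
  fixes p :: real
  assumes indep: "indep_vars M' X I" and I: "countable I" "infinite I"
    and A: "\<And>i. i \<in> I \<Longrightarrow> A i \<in> sets (M' i)"
    and p: "p > 0" "\<And>i. i \<in> I \<Longrightarrow> prob (X i -` A i \<inter> space M) = p"
  shows "AE \<omega> in M. infinite {i \<in> I. X i \<omega> \<in> A i}"
proof -
  have meas: "X i \<in> measurable M (M' i)" if "i \<in> I" for i
    using indep that by (auto simp: indep_vars_def)
  have p_le: "p \<le> 1"
    using I(2) p(2) by (metis finite.emptyI ex_in_conv prob_le_1)
  have ex: "AE \<omega> in M. \<exists>i\<in>I - C. X i \<omega> \<in> A i" if C: "finite C" for C
  proof -
    define B where "B i = space (M' i) - A i" for i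
    define E where "E = (\<Inter>i\<in>I - C. X i -` B i \<inter> space M)"
    have inf: "infinite (I - C)"
      using I C by simp
    have B: "B i \<in> sets (M' i)" if "i \<in> I" for i
      using A[OF that] by (auto simp: B_def)
    have E: "E \<in> events"
      unfolding E_def using I(1) infinite_imp_nonempty[OF inf] B meas
      by (intro sets.countable_INT') (auto intro: measurable_sets)
    have prob_B: "prob (X i -` B i \<inter> space M) = 1 - p" if "i \<in> I" for i
    proof -
      have "X i -` B i \<inter> space M = space M - (X i -` A i \<inter> space M)"
        using measurable_space[OF meas[OF that]] by (auto simp: B_def)
      then show ?thesis
        using prob_compl[OF measurable_sets[OF meas[OF that] A[OF that]]] p(2)[OF that] by simp
    qed
    have bound: "prob E \<le> (1 - p) ^ L" for L
    proof -
      \<comment> \<open>Independence yields the product formula for nonempty finite \<open>J\<close>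
        only; for \<open>L = 0\<close> the bound is trivial.\<close>
      consider "L = 0" | "L > 0" by auto
      then show ?thesis
      proof cases
        case 2
        obtain J where J: "finite J" "card J = L" "J \<subseteq> I - C"
          using infinite_arbitrarily_large[OF inf] by blast
        have "prob (\<Inter>i\<in>J. X i -` B i \<inter> space M) = (\<Prod>i\<in>J. prob (X i -` B i \<inter> space M))"
          using J 2 B by (intro indep_varsD[OF indep]) auto
        also have "\<dots> = (\<Prod>i\<in>J. 1 - p)"
          using J by (intro prod.cong) (auto simp: prob_B)
        finally have "prob (\<Inter>i\<in>J. X i -` B i \<inter> space M) = (1 - p) ^ L"
          using J by simp
        moreover have "(\<Inter>i\<in>J. X i -` B i \<inter> space M) \<in> events"
          using J 2 B meas by (intro sets.finite_INT) (auto intro: measurable_sets)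
        moreover have "E \<subseteq> (\<Inter>i\<in>J. X i -` B i \<inter> space M)"
          using J by (auto simp: E_def)
        ultimately show ?thesis
          by (metis finite_measure_mono)
      qed simp
    qed
    have "(\<lambda>L. (1 - p) ^ L) \<longlonglongrightarrow> 0"
      using p p_le by (intro LIMSEQ_realpow_zero) auto
    then have "prob E \<le> 0"
      using bound by (intro LIMSEQ_le_const) auto
    then have "prob E = 0"
      using measure_nonneg[of M E] by linarith
    then have "AE \<omega> in M. \<omega> \<notin> E"
      using E prob_eq_0 by blast
    moreover have "\<exists>i\<in>I - C. X i \<omega> \<in> A i" if "\<omega> \<in> space M" "\<omega> \<notin> E" for \<omega>
    proof (rule ccontr)
      assume "\<not> ?thesis"
      then have "\<forall>i\<in>I - C. \<omega> \<in> X i -` B i \<inter> space M"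
        using that measurable_space[OF meas] by (auto simp: B_def)
      with that show False
        unfolding E_def by blast
    qed
    ultimately show ?thesis
      by (auto intro: AE_mp)
  qed
  have "AE \<omega> in M. \<forall>C\<in>{C. finite C \<and> C \<subseteq> I}. \<exists>i\<in>I - C. X i \<omega> \<in> A i"
    using ex I by (intro AE_ball_countable'[OF _ countable_Collect_finite_subset]) auto
  then show ?thesis
  proof eventually_elim
    case (elim \<omega>)
    show ?case
    proof
      assume "finite {i \<in> I. X i \<omega> \<in> A i}"
      \<comment> \<open>A finite set of hits would itself be an admissible \<open>C\<close>, yet
        there is a hit outside it.\<close>
      then have "{i \<in> I. X i \<omega> \<in> A i} \<in> {C. finite C \<and> C \<subseteq> I}"
        by auto
      from bspec[OF elim this] show False
        by blast
    qed
  qed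
qed

text \<open>The bit is 0 exactly when the noise is at most \<open>\<tau> - \<theta>\<close>. The two
  values have probabilities \<open>?q\<close> and \<open>1 - ?q\<close>, both positive because
  \<open>F\<close> stays strictly between 0 and 1.\<close>

lemma (in sensor_network) AE_infinite_secure_period_bits:
  assumes j: "j \<in> N"
  shows "AE \<omega> in P. \<forall>x. infinite {m \<in> {1..}. secure_period_bits \<tau> \<theta> n0 \<omega> j m = x}"
proof -
  let ?q = "F (\<tau> - \<theta>)"
  have q: "0 < ?q" "?q < 1"
    using F_range by (metis greaterThanLessThan_iff rangeI)+
  let ?X = "case_sum (\<lambda>(j, m). n0 j m) (\<lambda>(j, k). n1 j k)" and ?I = "(\<lambda>m::nat. Inl (j, m)) ` {1..}"
  have indep: "indep_vars (\<lambda>_. borel) ?X ?I"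
    using j by (intro indep_vars_subset[OF noise_indep]) auto
  have I: "countable ?I" "infinite ?I"
    by (auto simp: finite_image_iff inj_on_def infinite_Ici)
  have meas: "n0 j m \<in> borel_measurable P" if "m \<ge> 1" for m
    using indep that by (auto simp: indep_vars_def)
  have le: "prob (n0 j m -` {..\<tau> - \<theta>} \<inter> space P) = ?q" if "m \<ge> 1" for m
    using n0_cdf[OF j that] meas[OF that] by (auto simp: cdf_def measure_distr)
  have gt: "prob (n0 j m -` {\<tau> - \<theta><..} \<inter> space P) = 1 - ?q" if "m \<ge> 1" for m
  proof -
    have "n0 j m -` {\<tau> - \<theta><..} \<inter> space P = space P - (n0 j m -` {..\<tau> - \<theta>} \<inter> space P)"
      by auto
    then show ?thesis
      using prob_compl[OF measurable_sets[OF meas[OF that]], of "{..\<tau> - \<theta>}"] le[OF that] by simp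
  qed
  have recur: "AE \<omega> in P. infinite {m \<in> {1..}. n0 j m \<omega> \<in> A}"
    if "A \<in> sets borel" "p > 0" "\<And>m. m \<ge> 1 \<Longrightarrow> prob (n0 j m -` A \<inter> space P) = p" for A p
  proof -
    have "AE \<omega> in P. infinite {i \<in> ?I. ?X i \<omega> \<in> A}"
      using that by (intro AE_infinitely_often_indep_vars[OF indep I, where p = p]) auto
    then show ?thesis
    proof eventually_elim
      case (elim \<omega>)
      have "{i \<in> ?I. ?X i \<omega> \<in> A} = (\<lambda>m. Inl (j, m)) ` {m \<in> {1..}. n0 j m \<omega> \<in> A}"
        by auto
      then show ?case
        using elim by auto
    qed
  qed
  have "AE \<omega> in P. infinite {m \<in> {1..}. n0 j m \<omega> \<in> {..\<tau> - \<theta>}}"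
    using q le by (intro recur[of _ ?q]) auto
  moreover have "AE \<omega> in P. infinite {m \<in> {1..}. n0 j m \<omega> \<in> {\<tau> - \<theta><..}}"
    using q gt by (intro recur[of _ "1 - ?q"]) auto
  ultimately show ?thesis
    by eventually_elim
      (auto simp: secure_period_bits_def all_bool_eq not_less algebra_simps)
qed

section \<open>Likelihoods at the estimators\<close>

text \<open>The bit value is a parameter so that one formula covers both branches of
  \<open>lik0\<close>.\<close>

definition bit_count :: "bool \<Rightarrow> ('a \<Rightarrow> nat \<Rightarrow> bool) \<Rightarrow> 'a set \<Rightarrow> nat \<Rightarrow> real" where
  "bit_count x w A n = (\<Sum>j\<in>A. \<Sum>i=1..n. of_bool (w j i = x))"

lemma bit_count_nonneg: "bit_count x w A n \<ge> 0"
  by (simp add: bit_count_def sum_nonneg)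

lemma bit_count_add_Not: "bit_count x w A n + bit_count (\<not> x) w A n = real n * real (card A)"
proof -
  have "of_bool (w j i = x) + of_bool (w j i = (\<not> x)) = (1::real)" for j i
    by auto
  then show ?thesis
    unfolding bit_count_def sum.distrib[symmetric] by simp
qed

text \<open>The other sensors contribute nonnegative counts, so the count of the single sensor
  \<open>j\<close> is a lower bound.\<close>

lemma filterlim_bit_count:
  assumes "finite A" "j \<in> A" and inf: "infinite {m \<in> {1..}. w j m = x}"
  shows "filterlim (bit_count x w A) at_top sequentially"
proof (rule filterlim_at_top_mono)
  let ?c = "\<lambda>n. card {m \<in> {1..n}. w j m = x}"
  show "\<forall>\<^sub>F n in sequentially. real (?c n) \<le> bit_count x w A n"
  proof (intro always_eventually allI)
    fix n
    have "real (?c n) = (\<Sum>i=1..n. of_bool (w j i = x))"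
      by (subst sum_of_bool_eq) (auto simp: Int_def)
    also have "\<dots> \<le> bit_count x w A n"
      unfolding bit_count_def using assms
      by (intro member_le_sum) (auto intro: sum_nonneg)
    finally show "real (?c n) \<le> bit_count x w A n" .
  qed
  have "filterlim ?c at_top sequentially"
    unfolding filterlim_at_top eventually_sequentially
  proof
    fix Z
    obtain B where B: "finite B" "card B = Z" "B \<subseteq> {m \<in> {1..}. w j m = x}"
      using infinite_arbitrarily_large[OF inf] by blast
    show "\<exists>n0. \<forall>n\<ge>n0. Z \<le> ?c n"
    proof (intro exI allI impI)
      \<comment> \<open>Once all \<open>Z\<close> chosen times have passed, the count is at least
        \<open>Z\<close>. Inserting 0 keeps \<open>Max\<close> meaningful when \<open>B\<close> is
        empty.\<close>
      fix n assume "n \<ge> Max (insert 0 B)"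
      then have "B \<subseteq> {m \<in> {1..n}. w j m = x}"
        using B by auto
      then show "Z \<le> ?c n"
        using B by (auto intro: card_mono)
    qed
  qed
  then show "filterlim (\<lambda>n. real (?c n)) at_top sequentially"
    by (rule filterlim_compose[OF filterlim_real_sequentially])
qed

text \<open>As \<open>\<tau>\<close> is finite, subtracting from it twice returns the quantile even
  at infinity, and the conventions in \<open>cdf_ext\<close> invert \<open>quantile\<close> at 0 and
  1 too.\<close>

lemma lik0_quantile:
  assumes "inj F" "range F = {0<..<1}" "0 \<le> p" "p \<le> 1"
  shows "lik0 F \<tau> x (ereal \<tau> - quantile F p) = (if x then 1 - p else p)"
proof -
  have "F (inv F p) = p" if "p \<noteq> 0" "p \<noteq> 1"
    using assms that by (intro f_inv_into_f) auto
  then show ?thesis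
    by (auto simp: lik0_def quantile_def cdf_ext_def)
qed

text \<open>The frequencies of zeros and ones add up to 1, so the argument of
  \<open>quantile\<close> is the frequency of zeros and lies in [0,1]; \<open>M \<ge> 1\<close>
  makes the sample size positive.\<close>

lemma lik0_theta_a:
  assumes "inj F" "range F = {0<..<1}" "finite N" "N \<noteq> {}" "M \<ge> 1"
  shows "lik0 F \<tau> x (theta_a F \<tau> N S v u K M)
    = (bit_count x v N M + bit_count x u S K) / real (M * card N + K * card S)"
proof -
  let ?D = "real (M * card N + K * card S)"
  let ?T = "\<lambda>x. bit_count x v N M + bit_count x u S K"
  have D: "?D > 0"
    using assms by (simp add: card_gt_0_iff add_pos_nonneg)
  have T: "?T True + ?T False = ?D" "0 \<le> ?T x" for x
    using bit_count_add_Not[of True v N M] bit_count_add_Not[of True u S K]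
      bit_count_nonneg[of x v N M] bit_count_nonneg[of x u S K]
    by (simp_all add: algebra_simps)
  have "?T False / ?D = 1 - 1 / ?D * ?T True"
    using D T by (simp add: field_simps)
  moreover have "0 \<le> ?T False / ?D" "?T False / ?D \<le> 1"
    using D T(1) T(2)[of False] T(2)[of True] by (simp_all add: field_simps)
  ultimately show ?thesis
    using D lik0_quantile[OF assms(1,2), of "1 - 1 / ?D * ?T True" \<tau> x]
    unfolding theta_a_def bit_count_def by (cases x) simp_all
qed

lemma lik0_theta_mle:
  assumes "inj F" "range F = {0<..<1}" "finite N" "N \<noteq> {}" "M \<ge> 1"
  shows "lik0 F \<tau> x (theta_mle F \<tau> N v u K M)
    = (bit_count x v N M + bit_count x u N K) / real ((M + K) * card N)"
proof -
  \<comment> \<open>The MLE is the estimator \<open>theta_a\<close> with every sensor declared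
    secure.\<close>
  have "theta_mle F \<tau> N v u K M = theta_a F \<tau> N N v u K M"
    by (simp add: theta_mle_def theta_a_def sum.distrib algebra_simps)
  then show ?thesis
    using lik0_theta_a[OF assms, of \<tau> x N v u K] by (simp add: algebra_simps)
qed

lemma tendsto_add_const_ratio:
  fixes f :: "'b \<Rightarrow> real"
  assumes "filterlim f at_top G"
  shows "((\<lambda>x. (f x + c) / (f x + d)) \<longlongrightarrow> 1) G"
proof -
  have "((\<lambda>t::real. (t + c) / (t + d)) \<longlongrightarrow> 1) at_top"
    by real_asymp
  then show ?thesis
    using assms by (rule filterlim_compose)
qed

lemma tendsto_lik0_ratio:
  assumes F: "inj F" "range F = {0<..<1}" and N: "finite N" "N \<noteq> {}"
    and count: "filterlim (bit_count x v N) at_top sequentially"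
  shows "(\<lambda>M. lik0 F \<tau> x (theta_a F \<tau> N S v u K M) / lik0 F \<tau> x (theta_mle F \<tau> N v u K M))
    \<longlonglongrightarrow> 1"
proof -
  let ?C = "bit_count x v N"
  have "card N > 0"
    using N by (auto simp: card_gt_0_iff)
  then have lin: "filterlim (\<lambda>M. real (card N) * real M) at_top sequentially"
    by (intro filterlim_tendsto_pos_mult_at_top[OF tendsto_const _ filterlim_real_sequentially]) auto
  \<comment> \<open>Counts are paired with counts and sample sizes with sample sizes: each factor
    compares two shifts by constants of one divergent quantity, first \<open>?C M\<close>, then
    \<open>card N * M\<close>.\<close>
  have "(\<lambda>M. (?C M + bit_count x u S K) / (?C M + bit_count x u N K)
      * ((real (card N) * real M + real (K * card N)) / (real (card N) * real M + real (K * card S))))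
    \<longlonglongrightarrow> 1 * 1"
    by (intro tendsto_mult tendsto_add_const_ratio count lin)
  moreover have "\<forall>\<^sub>F M in sequentially.
      (?C M + bit_count x u S K) / (?C M + bit_count x u N K)
      * ((real (card N) * real M + real (K * card N)) / (real (card N) * real M + real (K * card S)))
    = lik0 F \<tau> x (theta_a F \<tau> N S v u K M) / lik0 F \<tau> x (theta_mle F \<tau> N v u K M)"
    using eventually_ge_at_top[of 1]
    by eventually_elim (simp add: lik0_theta_a[OF F N] lik0_theta_mle[OF F N] algebra_simps)
  ultimately show ?thesis
    by (simp add: filterlim_cong)
qed

section \<open>Comparison of the test statistics\<close>

text \<open>The number of summands does not grow with \<open>M\<close>, so termwise convergence to
  \<open>ln 1\<close> suffices.\<close>

lemma tendsto_eta3: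
  assumes F: "inj F" "range F = {0<..<1}" and N: "finite N" "N \<noteq> {}"
    and count: "\<And>x. filterlim (bit_count x v N) at_top sequentially"
  shows "(\<lambda>M. eta3 F \<tau> N S v u K M k) \<longlonglongrightarrow> 0"
proof -
  have "(\<lambda>M. eta3 F \<tau> N S v u K M k) \<longlonglongrightarrow> (\<Sum>i=1..k-1. \<Sum>j\<in>N-S. ln 1)"
    unfolding eta3_def
    by (intro tendsto_sum tendsto_ln tendsto_lik0_ratio[OF F N count]) simp
  then show ?thesis by simp
qed

lemma abs_Max_image_diff_le:
  fixes f g :: "'b \<Rightarrow> real"
  assumes "finite A" "A \<noteq> {}" "\<And>k. k \<in> A \<Longrightarrow> \<bar>f k - g k\<bar> \<le> e"
  shows "\<bar>Max (f ` A) - Max (g ` A)\<bar> \<le> e"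
proof -
  have "Max (f ` A) \<le> Max (g ` A) + e"
    if "\<And>k. k \<in> A \<Longrightarrow> \<bar>f k - g k\<bar> \<le> e" for f g :: "'b \<Rightarrow> real"
  proof (intro Max.boundedI)
    fix y assume "y \<in> f ` A"
    then obtain k where k: "k \<in> A" "y = f k" by blast
    then have "g k \<le> Max (g ` A)" using assms(1) by simp
    then show "y \<le> Max (g ` A) + e" using that[OF k(1)] k(2) by linarith
  qed (use assms in auto)
  from this[of f g] this[of g f] show ?thesis
    using assms(3) by (simp add: abs_minus_commute abs_le_iff)
qed

lemma tendsto_H_A_H_G:
  assumes F: "inj F" "range F = {0<..<1}" and N: "finite N" "N \<noteq> {}" and K: "K \<ge> 1"
    and count: "\<And>x. filterlim (bit_count x v N) at_top sequentially"
  shows "(\<lambda>M. \<bar>H_A F \<tau> b N S v u K M - H_G F \<tau> b N S v u K M\<bar>) \<longlonglongrightarrow> 0"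
proof (rule Lim_null_comparison)
  \<comment> \<open>\<open>eta1\<close> and \<open>eta2\<close> cancel in the difference. The sum
    over \<open>k\<close> dominates every single \<open>eta3\<close> in absolute value and is a
    finite sum of null sequences.\<close>
  let ?s = "\<lambda>M. \<Sum>k=1..K. \<bar>eta3 F \<tau> N S v u K M k\<bar>"
  show "?s \<longlonglongrightarrow> 0"
    by (intro tendsto_null_sum tendsto_rabs_zero tendsto_eta3[OF F N count])
  show "\<forall>\<^sub>F M in sequentially.
      norm \<bar>H_A F \<tau> b N S v u K M - H_G F \<tau> b N S v u K M\<bar> \<le> ?s M"
  proof (intro always_eventually allI)
    fix M
    have "\<bar>Max (eta4 F \<tau> b N S v u K M ` {1..K})
        - Max ((\<lambda>k. eta3 F \<tau> N S v u K M k + eta4 F \<tau> b N S v u K M k) ` {1..K})\<bar> \<le> ?s M"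
      using K by (intro abs_Max_image_diff_le)
        (auto intro!: member_le_sum[where f = "\<lambda>k. \<bar>eta3 F \<tau> N S v u K M k\<bar>"])
    then show "norm \<bar>H_A F \<tau> b N S v u K M - H_G F \<tau> b N S v u K M\<bar> \<le> ?s M"
      by (simp add: H_A_def H_G_def)
  qed
qed

theorem theorem3:
  fixes P :: "'w measure"
    and F :: "real \<Rightarrow> real"
    and \<tau> \<theta> b :: real
    and N S :: "'a set"
    and \<mu> :: "'a \<Rightarrow> real"
    and t\<^sub>A :: enat
    and n0 n1 :: "'a \<Rightarrow> nat \<Rightarrow> 'w \<Rightarrow> real"
    and K :: nat
  assumes "sensor_network P F b N S \<mu> t\<^sub>A n0 n1"
    and "K \<ge> 1"
  shows "(\<forall>u :: 'a \<Rightarrow> nat \<Rightarrow> bool. AE \<omega> in P.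
           (\<lambda>M. \<bar>H_A F \<tau> b N S (secure_period_bits \<tau> \<theta> n0 \<omega>) u K M
               - H_G F \<tau> b N S (secure_period_bits \<tau> \<theta> n0 \<omega>) u K M\<bar>) \<longlonglongrightarrow> 0)
       \<and> (AE \<omega> in P.
           (\<lambda>M. \<bar>H_A F \<tau> b N S (secure_period_bits \<tau> \<theta> n0 \<omega>)
                   (post_period_bits \<tau> \<theta> N S \<mu> t\<^sub>A n1 \<omega>) K M
               - H_G F \<tau> b N S (secure_period_bits \<tau> \<theta> n0 \<omega>)
                   (post_period_bits \<tau> \<theta> N S \<mu> t\<^sub>A n1 \<omega>) K M\<bar>) \<longlonglongrightarrow> 0)"


proof -
  interpret sensor_network P F b N S \<mu> t\<^sub>A n0 n1 by fact
  obtain j where j: "j \<in> N"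
    using sensors_nonempty by blast
  \<comment> \<open>The null set depends on the secure period alone and is fixed before
    \<open>u\<close>, so \<open>u\<close> may vary with \<open>\<omega>\<close>. This gives both the
    held-fixed bits and the random ones, attacked or not.\<close>
  have "AE \<omega> in P. \<forall>u. (\<lambda>M. \<bar>H_A F \<tau> b N S (secure_period_bits \<tau> \<theta> n0 \<omega>) u K M
               - H_G F \<tau> b N S (secure_period_bits \<tau> \<theta> n0 \<omega>) u K M\<bar>) \<longlonglongrightarrow> 0"
    using AE_infinite_secure_period_bits[OF j, of \<tau> \<theta>]
  proof eventually_elim
    case (elim \<omega>)
    have "filterlim (bit_count x (secure_period_bits \<tau> \<theta> n0 \<omega>) N) at_top sequentially" for x
      using finite_sensors j elim by (intro filterlim_bit_count) auto
    then show ?case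
      using F_strict_mono F_range finite_sensors sensors_nonempty \<open>K \<ge> 1\<close>
      by (intro allI tendsto_H_A_H_G strict_mono_imp_inj_on) auto
  qed
  then show ?thesis
    by (intro conjI allI; eventually_elim) blast+
qed

end
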